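(* Let $X$ be a separable infinite dimensional Banach space which is elastic. Then $X$ contains a subspace isomorphic to $c_0$.
   Context: A Banach space $Y$ $K$-embeds into $X$ if there is a linear map $T:Y\to X$ with $\|y\|\le\|Ty\|\le K\|y\|$ for all $y\in Y$. $X$ is $K$-elastic if every Banach space $Y$ isomorphic to a subspace of $X$ $K$-embeds into $X$; $X$ is elastic if it is $K$-elastic for some $K<\infty$. *)

theory Defs
  imports "HOL-Analysis.Analysis"
begin

definition separable_space :: "'a::metric_space itself \<Rightarrow> bool" where
  "separable_space _ \<longleftrightarrow> (\<exists>D::'a set. countable D \<and> closure D = UNIV)"

definition infinite_dimensional :: "'a::real_vector itself \<Rightarrow> bool" where
  "infinite_dimensional _ \<longleftrightarrow> \<not> (\<exists>B::'a set. finite B \<and> span B = UNIV)"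

definition linear_on_set :: "'a::real_vector set \<Rightarrow> ('a \<Rightarrow> 'b::real_vector) \<Rightarrow> bool" where
  "linear_on_set Z T \<longleftrightarrow>
     (\<forall>x\<in>Z. \<forall>y\<in>Z. T (x + y) = T x + T y) \<and> (\<forall>c. \<forall>x\<in>Z. T (c *\<^sub>R x) = c *\<^sub>R T x)"

text \<open>N is a norm on the subspace Z equivalent to the restriction of the norm of X.
  Every Banach space Y isomorphic to a subspace of X is isometric to (Z, N) for
  the closed subspace Z = S(Y) and N z = norm_Y (S^-1 z), where S is the isomorphism;
  conversely every such (Z, N), Z closed, is a Banach space isomorphic to Z.\<close>
definition equiv_norm_on :: "'a::real_normed_vector set \<Rightarrow> ('a \<Rightarrow> real) \<Rightarrow> bool" where
  "equiv_norm_on Z N \<longleftrightarrow>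
     (\<forall>x\<in>Z. \<forall>y\<in>Z. N (x + y) \<le> N x + N y) \<and>
     (\<forall>c. \<forall>x\<in>Z. N (c *\<^sub>R x) = \<bar>c\<bar> * N x) \<and>
     (\<exists>a b. 0 < a \<and> 0 < b \<and> (\<forall>z\<in>Z. a * norm z \<le> N z \<and> N z \<le> b * norm z))"

definition K_embeds :: "real \<Rightarrow> 'a::real_normed_vector set \<Rightarrow> ('a \<Rightarrow> real) \<Rightarrow> 'b::real_normed_vector itself \<Rightarrow> bool" where
  "K_embeds K Z N _ \<longleftrightarrow>
     (\<exists>T::'a \<Rightarrow> 'b. linear_on_set Z T \<and> (\<forall>y\<in>Z. N y \<le> norm (T y) \<and> norm (T y) \<le> K * N y))"

definition K_elastic :: "real \<Rightarrow> 'a::banach itself \<Rightarrow> bool" where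
  "K_elastic K X \<longleftrightarrow>
     (\<forall>Z::'a set. \<forall>N. subspace Z \<and> closed Z \<and> equiv_norm_on Z N \<longrightarrow> K_embeds K Z N X)"

definition elastic :: "'a::banach itself \<Rightarrow> bool" where
  "elastic X \<longleftrightarrow> (\<exists>K. K_elastic K X)"

definition c0 :: "(nat \<Rightarrow> real) set" where
  "c0 = {x. x \<longlonglongrightarrow> 0}"

definition c0_norm :: "(nat \<Rightarrow> real) \<Rightarrow> real" where
  "c0_norm x = (SUP n. \<bar>x n\<bar>)"

text \<open>X contains a subspace isomorphic to c_0: an isomorphic embedding of c_0 into X
  (its image is then a closed subspace isomorphic to c_0).\<close>
definition contains_c0 :: "'a::real_normed_vector itself \<Rightarrow> bool" where
  "contains_c0 _ \<longleftrightarrow>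
     (\<exists>(T::(nat \<Rightarrow> real) \<Rightarrow> 'a) a b.
        (\<forall>x\<in>c0. \<forall>y\<in>c0. T (\<lambda>n. x n + y n) = T x + T y) \<and>
        (\<forall>c. \<forall>x\<in>c0. T (\<lambda>n. c * x n) = c *\<^sub>R T x) \<and> 0 < a \<and> 0 < b \<and>
        (\<forall>x\<in>c0. a * c0_norm x \<le> norm (T x) \<and> norm (T x) \<le> b * c0_norm x))"

end

theory Submission
  imports Defs "HOL-Library.Ramsey" "HOL-Library.Sublist"
begin

text \<open>
  Fix a dense sequence \<open>e\<close> in a \<open>K\<close>-elastic space and consider the tree \<open>\<T>\<close> of finite sequences
  of indices along which \<open>e\<close> is uniformly equivalent to the unit vector basis of \<open>c\<^sub>0\<close>; an infinite
  branch spans \<open>c\<^sub>0\<close>. Suppose that \<open>\<T>\<close> is well-founded. By induction along \<open>\<T>\<close> one finds vectors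
  \<open>x (t, n)\<close>, one sequence for each node \<open>t\<close> above \<open>s\<close>, with coordinate functionals of norm at most
  \<open>1\<close>, such that every choice of one vector from each node of a branch has upper \<open>c\<^sub>0\<close>-estimates with
  constant \<open>K\<close>. In the induction step the families of the children and a new sequence at the root
  are combined: replacing vectors by suitable differences makes the union uniformly minimal, at the
  cost of the constants. The constants are restored by passing to the equivalent norm
  whose unit ball is generated by the branch sums and a multiple of the old ball, and then
  embedding the renormed space back with constant \<open>K\<close>. At the root of \<open>\<T>\<close> the family yields a
  contradiction: approximating \<open>x (s, 0)\<close> by some \<open>e d\<close> and moving from \<open>s\<close> to \<open>s @ [d]\<close> never leaves
  \<open>\<T>\<close>.
\<close>

section \<open>Selection of uniformly minimal differences\<close>

text \<open>A Mazur-type selection without functionals: if all differences failed, Ramsey would give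
  essentially one pair \<open>(g, t)\<close> that is bad for all consecutive differences of a subsequence, and
  averaging these telescopes to \<open>g\<close> alone.\<close>

lemma exists_difference_almost_orthogonal:
  fixes w :: "nat \<Rightarrow> 'a::real_normed_vector"
  assumes S: "compact S" "\<And>g. g \<in> S \<Longrightarrow> norm g = 1"
    and w: "\<And>i. norm (w i) \<le> b" and \<theta>: "\<theta> < 1"
  shows "\<exists>p q. p < q \<and> (\<forall>g\<in>S. \<forall>t. \<bar>t\<bar> \<le> R \<longrightarrow> \<theta> \<le> norm (g + t *\<^sub>R (w p - w q)))"
proof (rule ccontr)
  assume "\<not> ?thesis"
  then have ex: "\<exists>g\<in>S. \<exists>t. \<bar>t\<bar> \<le> R \<and> norm (g + t *\<^sub>R (w p - w q)) < \<theta>" if "p < q" for p q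
    using that by (meson not_le)
  have "\<exists>v. p < q \<longrightarrow> v \<in> S \<times> {-R..R} \<and> norm (fst v + snd v *\<^sub>R (w p - w q)) < \<theta>" for p q
  proof (cases "p < q")
    case True
    from ex[OF this] obtain g t where "g \<in> S" "\<bar>t\<bar> \<le> R" "norm (g + t *\<^sub>R (w p - w q)) < \<theta>" by blast
    then show ?thesis by (intro exI[of _ "(g, t)"]) auto
  qed simp
  then obtain v where v: "\<And>p q. p < q \<Longrightarrow> v p q \<in> S \<times> {-R..R}"
      "\<And>p q. p < q \<Longrightarrow> norm (fst (v p q) + snd (v p q) *\<^sub>R (w p - w q)) < \<theta>"
    by metis
  have b: "0 \<le> b" using w[of 0] norm_ge_zero order_trans by blast
  have wd: "norm (w p - w q) \<le> 2 * b" for p q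
    using norm_triangle_ineq4[of "w p" "w q"] w[of p] w[of q] by linarith
  \<comment> \<open>With this \<open>\<eta>\<close>, the lower bound \<open>1 - \<eta>\<close> for
    \<open>norm g\<close> exceeds the upper bound \<open>\<theta> + \<eta> * (1 + 2 * b)\<close> for
    one consecutive difference by \<open>(1 - \<theta>) / 2\<close>.\<close>
  define \<eta> where "\<eta> = (1 - \<theta>) / (4 * (1 + b))"
  have \<eta>: "0 < \<eta>" "\<eta> * (2 + 2 * b) = (1 - \<theta>) / 2"
    using b \<theta> by (auto simp: \<eta>_def field_simps)
  have "compact (S \<times> {-R..R})" using S by (intro compact_Times) auto
  then obtain F where F: "finite F" "S \<times> {-R..R} \<subseteq> (\<Union>x\<in>F. ball x \<eta>)"
    using \<eta>(1) by (auto simp: compact_eq_totally_bounded)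
  have "\<forall>p q. \<exists>c. p < q \<longrightarrow> c \<in> F \<and> dist c (v p q) < \<eta>"
  proof (intro allI)
    fix p q
    show "\<exists>c. p < q \<longrightarrow> c \<in> F \<and> dist c (v p q) < \<eta>"
    proof (cases "p < q")
      case True
      then have "v p q \<in> (\<Union>x\<in>F. ball x \<eta>)" using F(2) v(1) by blast
      then show ?thesis by auto
    qed simp
  qed
  then obtain c where c: "\<And>p q. p < q \<Longrightarrow> c p q \<in> F" "\<And>p q. p < q \<Longrightarrow> dist (c p q) (v p q) < \<eta>"
    by metis
  obtain n and h :: "'a \<times> real \<Rightarrow> nat" where h: "h ` F = {i. i < n}" "inj_on h F"
    using finite_imp_inj_to_nat_seg[OF F(1)] by blast
  \<comment> \<open>A pair is coloured by the net point that approximates its bad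
    \<open>(g, t)\<close>; \<open>Min\<close> and \<open>Max\<close> recover the order that an
    unordered pair forgets.\<close>
  define f where "f P = h (c (Min P) (Max P))" for P
  have fp: "f {p, q} = h (c p q)" if "p < q" for p q
    using that by (simp add: f_def)
  have "\<forall>x\<in>UNIV. \<forall>y\<in>UNIV. x \<noteq> y \<longrightarrow> f {x, y} < n"
  proof (intro ballI impI)
    fix x y :: nat assume "x \<noteq> y"
    then have "Min {x, y} < Max {x, y}" by auto
    then have "h (c (Min {x, y}) (Max {x, y})) \<in> h ` F" using c(1) by blast
    then show "f {x, y} < n" using h by (simp add: f_def)
  qed
  from Ramsey2[OF infinite_UNIV_nat this] obtain Y k where Y: "infinite Y"
      "\<forall>x\<in>Y. \<forall>y\<in>Y. x \<noteq> y \<longrightarrow> f {x, y} = k" by blast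
  define i where "i = enumerate Y"
  have i: "i l \<in> Y" "i l < i (Suc l)" for l
    using Y(1) by (auto simp: i_def enumerate_in_set enumerate_step)
  define c0 where "c0 = c (i 0) (i 1)"
  have ceq: "c (i l) (i (Suc l)) = c0" for l
  proof -
    have "h (c (i l) (i (Suc l))) = k" "h c0 = k"
      using Y(2) i(1) i(2)[of l] i(2)[of 0] fp[OF i(2)[of l]] fp[OF i(2)[of 0]]
      by (auto simp: c0_def)
    then show ?thesis
      using inj_onD[OF h(2)] c(1)[OF i(2)[of l]] c(1)[OF i(2)[of 0]] unfolding c0_def by simp
  qed
  define g t where "g = fst c0" and "t = snd c0"
  have close: "norm (g - fst (v (i l) (i (Suc l)))) < \<eta>" "\<bar>t - snd (v (i l) (i (Suc l)))\<bar> < \<eta>" for l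
  proof -
    have d: "dist c0 (v (i l) (i (Suc l))) < \<eta>" using c(2)[OF i(2)[of l]] ceq by simp
    show "norm (g - fst (v (i l) (i (Suc l)))) < \<eta>"
      using d dist_fst_le[of c0 "v (i l) (i (Suc l))"] by (simp add: g_def dist_norm)
    show "\<bar>t - snd (v (i l) (i (Suc l)))\<bar> < \<eta>"
      using d dist_snd_le[of c0 "v (i l) (i (Suc l))"] by (simp add: t_def dist_norm)
  qed
  have g1: "1 - \<eta> \<le> norm g"
  proof -
    have "norm (fst (v (i 0) (i 1))) = 1" using v(1)[OF i(2)[of 0]] S(2) by (auto simp: mem_Times_iff)
    then show ?thesis using close(1)[of 0] norm_triangle_ineq2[of "fst (v (i 0) (i 1))" g]
      by (simp add: norm_minus_commute)
  qed
  have step: "norm (g + t *\<^sub>R (w (i l) - w (i (Suc l)))) \<le> \<theta> + \<eta> * (1 + 2 * b)" for l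
  proof -
    let ?v = "v (i l) (i (Suc l))" and ?z = "w (i l) - w (i (Suc l))"
    have "norm (g + t *\<^sub>R ?z) = norm ((fst ?v + snd ?v *\<^sub>R ?z) + ((g - fst ?v) + (t - snd ?v) *\<^sub>R ?z))"
      by (simp add: algebra_simps)
    also have "\<dots> \<le> norm (fst ?v + snd ?v *\<^sub>R ?z) + (norm (g - fst ?v) + norm ((t - snd ?v) *\<^sub>R ?z))"
      by (intro norm_triangle_le add_left_mono norm_triangle_ineq)
    also have "\<dots> \<le> \<theta> + (\<eta> + \<eta> * (2 * b))"
    proof -
      have "norm ((t - snd ?v) *\<^sub>R ?z) \<le> \<eta> * (2 * b)"
        using close(2)[of l] wd \<eta> by (simp del: scaleR_right_diff_distrib) (intro mult_mono; simp)
      then show ?thesis using v(2)[OF i(2)[of l]] close(1)[of l] by linarith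
    qed
    finally show ?thesis by (simp add: algebra_simps)
  qed
  \<comment> \<open>Over \<open>m\<close> consecutive differences the \<open>w\<close> terms
    telescope to a bounded remainder, so \<open>m\<close> times the gap would stay bounded.\<close>
  have "real m * (1 - \<theta>) / 2 \<le> \<bar>t\<bar> * (2 * b)" for m
  proof -
    have tel: "(\<Sum>l<m. g + t *\<^sub>R (w (i l) - w (i (Suc l)))) = real m *\<^sub>R g + t *\<^sub>R (w (i 0) - w (i m))"
      by (induction m) (auto simp: algebra_simps)
    have "real m * norm g - \<bar>t\<bar> * (2 * b) \<le> norm (real m *\<^sub>R g) - norm (t *\<^sub>R (w (i 0) - w (i m)))"
      using wd[of "i 0" "i m"] by (simp add: mult_left_mono del: scaleR_right_diff_distrib)
    also have "\<dots> \<le> norm (\<Sum>l<m. g + t *\<^sub>R (w (i l) - w (i (Suc l))))"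
      unfolding tel by (metis add.commute diff_minus_eq_add norm_minus_cancel norm_triangle_ineq2)
    also have "\<dots> \<le> (\<Sum>l<m. \<theta> + \<eta> * (1 + 2 * b))"
      using step by (rule sum_norm_le)
    finally have "real m * norm g - \<bar>t\<bar> * (2 * b) \<le> real m * (\<theta> + \<eta> * (1 + 2 * b))" by simp
    moreover have "real m * (1 - \<eta>) \<le> real m * norm g" using g1 by (rule mult_left_mono) simp
    ultimately have "real m * (1 - \<eta> - (\<theta> + \<eta> * (1 + 2 * b))) \<le> \<bar>t\<bar> * (2 * b)"
      by (simp add: right_diff_distrib)
    moreover have "1 - \<eta> - (\<theta> + \<eta> * (1 + 2 * b)) = (1 - \<theta>) / 2"
      using \<eta>(2) by (simp add: algebra_simps)
    ultimately show ?thesis by simp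
  qed
  moreover obtain m where "\<bar>t\<bar> * (2 * b) < real m * ((1 - \<theta>) / 2)"
    using reals_Archimedean3[of "(1 - \<theta>) / 2"] \<theta> by (meson diff_gt_0_iff_gt half_gt_zero)
  ultimately show False by (metis not_le times_divide_eq_right)
qed

text \<open>A further summand amounts to a Minkowski sum with the compact image of an
  interval.\<close>

lemma compact_bounded_combinations:
  fixes z :: "nat \<Rightarrow> 'a::real_normed_vector"
  shows "compact {(\<Sum>j<k. a j *\<^sub>R z j) | a. \<forall>j<k. \<bar>a j\<bar> \<le> (R::real)}"
proof (induction k)
  case 0
  then show ?case by (simp add: setcompr_eq_image)
next
  case (Suc k)
  let ?B = "\<lambda>k. {(\<Sum>j<k. a j *\<^sub>R z j) | a. \<forall>j<k. \<bar>a j\<bar> \<le> R}"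
  have "compact ((\<lambda>t. t *\<^sub>R z k) ` {-R..R})"
    by (intro compact_continuous_image continuous_intros) auto
  from compact_sums[OF Suc this]
  have "compact {x + y |x y. x \<in> ?B k \<and> y \<in> (\<lambda>t. t *\<^sub>R z k) ` {-R..R}}" .
  also have "{x + y |x y. x \<in> ?B k \<and> y \<in> (\<lambda>t. t *\<^sub>R z k) ` {-R..R}} = ?B (Suc k)" (is "?L = _")
  proof (intro equalityI subsetI)
    fix v assume "v \<in> ?L"
    then obtain a t where a: "\<forall>j<k. \<bar>a j\<bar> \<le> R" "t \<in> {-R..R}" "v = (\<Sum>j<k. a j *\<^sub>R z j) + t *\<^sub>R z k"
      by blast
    then have "v = (\<Sum>j<Suc k. (a(k := t)) j *\<^sub>R z j) \<and> (\<forall>j<Suc k. \<bar>(a(k := t)) j\<bar> \<le> R)"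
      by (auto simp: less_Suc_eq abs_le_iff)
    then show "v \<in> ?B (Suc k)" by blast
  next
    fix v assume "v \<in> ?B (Suc k)"
    then obtain a where a: "\<forall>j<Suc k. \<bar>a j\<bar> \<le> R" "v = (\<Sum>j<k. a j *\<^sub>R z j) + a k *\<^sub>R z k"
      by auto
    moreover have "a k \<in> {-R..R}" using a(1) by (auto simp: abs_le_iff dest: spec[of _ k])
    moreover have "(\<Sum>j<k. a j *\<^sub>R z j) \<in> ?B k" using a(1) less_SucI by blast
    ultimately show "v \<in> ?L" by blast
  qed
  finally show ?case .
qed

text \<open>For the partial sums \<open>s m\<close>, the quotients \<open>norm (s m) / u m\<close>
  increase with \<open>m\<close>. Since \<open>u\<close> stays between 1 and 2, no partial sum
  exceeds twice the norm of the full sum; a single term is a difference of two partial sums, whence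
  4.\<close>

lemma coefficient_bound:
  fixes z :: "nat \<Rightarrow> 'a::real_normed_vector" and u :: "nat \<Rightarrow> real"
  assumes u: "\<And>k. 1 \<le> u k" "\<And>k. u k \<le> 2"
    and mono: "\<And>k a t. k < n \<Longrightarrow>
      u (Suc k) * norm (\<Sum>j<k. a j *\<^sub>R z j) \<le> u k * norm ((\<Sum>j<k. a j *\<^sub>R z j) + t *\<^sub>R z k)"
    and z: "\<And>k. k < n \<Longrightarrow> 1 \<le> norm (z k)" and j: "j < n"
  shows "\<bar>a j\<bar> \<le> 4 * norm (\<Sum>j<n. a j *\<^sub>R z j)"
proof -
  define s where "s m = (\<Sum>j<m. a j *\<^sub>R z j)" for m
  have inc: "norm (s m) / u m \<le> norm (s n) / u n" if "m \<le> n" for m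
    using that
  proof (induction rule: inc_induct)
    case (step k)
    have "u (Suc k) * norm (s k) \<le> u k * norm (s (Suc k))"
      using mono[OF step(2), of a "a k"] by (simp add: s_def)
    moreover have "0 < u k" "0 < u (Suc k)" using u by (meson less_le_trans zero_less_one)+
    ultimately have "norm (s k) / u k \<le> norm (s (Suc k)) / u (Suc k)"
      by (simp add: field_simps)
    then show ?case using step by simp
  qed simp
  have two: "norm (s m) \<le> 2 * norm (s n)" if "m \<le> n" for m
  proof -
    have p: "0 < u m" "0 < u n" using u by (meson less_le_trans zero_less_one)+
    have "norm (s m) \<le> u m * (norm (s n) / u n)" using inc[OF that] p by (simp add: field_simps)
    also have "\<dots> \<le> 2 * norm (s n)"
      using u p mult_right_mono[OF u(1)[of n] norm_ge_zero[of "s n"]]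
      by (intro mult_mono) (auto simp: field_simps)
    finally show ?thesis .
  qed
  have "\<bar>a j\<bar> \<le> \<bar>a j\<bar> * norm (z j)" using z[OF j] by (simp add: mult_le_cancel_left1)
  also have "\<dots> = norm (s (Suc j) - s j)" by (simp add: s_def)
  also have "\<dots> \<le> norm (s (Suc j)) + norm (s j)" by (rule norm_triangle_ineq4)
  also have "\<dots> \<le> 4 * norm (s n)" using two[of j] two[of "Suc j"] j by simp
  finally show ?thesis by (simp add: s_def)
qed

text \<open>As in Mazur's construction of basic sequences, the difference taken from
  \<open>w k\<close> is chosen almost orthogonal to the span of the earlier ones.\<close>

lemma exists_uniformly_minimal_differences:
  fixes w :: "nat \<Rightarrow> nat \<Rightarrow> 'a::real_normed_vector"
  assumes w: "\<And>k i. norm (w k i) \<le> b k" and sep: "\<And>k i j. i \<noteq> j \<Longrightarrow> 1 \<le> norm (w k i - w k j)"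
  shows "\<exists>p q. \<forall>A a. finite A \<longrightarrow>
    (\<forall>k\<in>A. \<bar>a k\<bar> \<le> 4 * norm (\<Sum>j\<in>A. a j *\<^sub>R (w j (p j) - w j (q j))))"
proof -
  \<comment> \<open>\<open>u\<close> decreases from 2 towards 1: each ratio
    \<open>u (Suc k) / u k\<close> is below 1, as the selection requires, yet all of them together
    lose at most a factor 2.\<close>
  define u :: "nat \<Rightarrow> real" where "u k = (real k + 2) / (real k + 1)" for k
  have u: "1 \<le> u k" "u k \<le> 2" "u (Suc k) < u k" for k
    by (auto simp: u_def field_simps)
  define d where "d k r = w k (fst r) - w k (snd r)" for k r
  define P where "P f k r \<longleftrightarrow> fst r \<noteq> snd r \<and> (\<forall>a t.
      u (Suc k) * norm (\<Sum>j<k. a j *\<^sub>R d j (f j)) \<le> u k * norm ((\<Sum>j<k. a j *\<^sub>R d j (f j)) + t *\<^sub>R d k r))" for f k r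
  have d1: "1 \<le> norm (d k r)" if "fst r \<noteq> snd r" for k r using sep[OF that] by (simp add: d_def)
  have bound: "\<bar>a j\<bar> \<le> 4 * norm (\<Sum>j<n. a j *\<^sub>R d j (f j))"
    if "\<And>k. k < n \<Longrightarrow> P f k (f k)" "j < n" for f a j n
    by (rule coefficient_bound[where u = u]) (use u that d1 in \<open>auto simp: P_def\<close>)
  have "\<exists>f. \<forall>k. P f k (f k)"
  proof (rule dependent_wellorder_choice)
    fix r and f g :: "nat \<Rightarrow> nat \<times> nat" and x :: nat
    assume "\<And>y. y < x \<Longrightarrow> f y = g y"
    then have "(\<Sum>j<x. a j *\<^sub>R d j (f j)) = (\<Sum>j<x. a j *\<^sub>R d j (g j))" for a by simp
    then show "P f x r = P g x r" by (simp add: P_def)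
  next
    fix k :: nat and f :: "nat \<Rightarrow> nat \<times> nat"
    assume IH: "\<And>y. y < k \<Longrightarrow> P f y (f y)"
    let ?s = "\<lambda>a. \<Sum>j<k. a j *\<^sub>R d j (f j)"
    \<comment> \<open>By the coefficient bound for the earlier differences, this is the whole unit
      sphere of their span, written so that compactness is visible.\<close>
    define S where "S = {?s a | a. \<forall>j<k. \<bar>a j\<bar> \<le> 4} \<inter> {g. norm g = 1}"
    have "closed {g::'a. norm g = 1}" by (intro closed_Collect_eq continuous_intros)
    then have S: "compact S" unfolding S_def by (intro compact_Int_closed compact_bounded_combinations)
    have \<theta>: "u (Suc k) / u k < 1" using u[of k] by simp
    \<comment> \<open>Bounded \<open>t\<close> suffice: for \<bar>t\<bar> > 2 the difference, of
      norm at least 1, dominates the unit vector \<open>g\<close> by the triangle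
      inequality.\<close>
    have "\<exists>p q. p < q \<and> (\<forall>g\<in>S. \<forall>t. \<bar>t\<bar> \<le> 2 \<longrightarrow> u (Suc k) / u k \<le> norm (g + t *\<^sub>R (w k p - w k q)))"
      by (rule exists_difference_almost_orthogonal[OF S _ w \<theta>]) (auto simp: S_def)
    then obtain p q where pq: "p < q"
      "\<And>g t. g \<in> S \<Longrightarrow> \<bar>t\<bar> \<le> 2 \<Longrightarrow> u (Suc k) / u k \<le> norm (g + t *\<^sub>R (w k p - w k q))" by blast
    have "u (Suc k) * norm (?s a) \<le> u k * norm (?s a + t *\<^sub>R d k (p, q))" for a t
    proof (cases "?s a = 0")
      case True
      then show ?thesis using u(1)[of k] by (simp add: mult_nonneg_nonneg)
    next
      case False
      define c where "c = norm (?s a)"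
      have c: "0 < c" using False by (simp add: c_def)
      define g where "g = (1 / c) *\<^sub>R ?s a"
      have g1: "norm g = 1" using c by (simp add: g_def c_def)
      have "\<bar>a j / c\<bar> \<le> 4" if "j < k" for j
        using bound[OF IH that, of a] c by (simp add: field_simps c_def)
      moreover have "g = ?s (\<lambda>j. a j / c)" by (simp add: g_def scaleR_sum_right)
      ultimately have gS: "g \<in> S" unfolding S_def using g1
        by (intro IntI CollectI exI[of _ "\<lambda>j. a j / c"]) auto
      have "u (Suc k) / u k \<le> norm (g + (t / c) *\<^sub>R d k (p, q))"
      proof (cases "\<bar>t / c\<bar> \<le> 2")
        case True
        then show ?thesis using pq(2)[OF gS] by (simp add: d_def)
      next
        case False
        have "\<bar>t / c\<bar> * 1 \<le> \<bar>t / c\<bar> * norm (d k (p, q))"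
          using d1[of "(p, q)" k] pq(1) by (intro mult_left_mono) auto
        then have "2 \<le> norm ((t / c) *\<^sub>R d k (p, q))" using False by (simp del: abs_divide)
        then have "1 \<le> norm (g + (t / c) *\<^sub>R d k (p, q))"
          using norm_diff_ineq[of "(t / c) *\<^sub>R d k (p, q)" g] g1 by (simp add: add.commute)
        then show ?thesis using \<theta> by simp
      qed
      also have "g + (t / c) *\<^sub>R d k (p, q) = (1 / c) *\<^sub>R (?s a + t *\<^sub>R d k (p, q))"
        by (simp add: g_def scaleR_add_right)
      finally have "u (Suc k) / u k \<le> norm (?s a + t *\<^sub>R d k (p, q)) / c" using c by simp
      moreover have "0 < u k" using u(1)[of k] by simp
      ultimately show ?thesis using c by (simp add: field_simps c_def)
    qed
    then have "P f k (p, q)" using pq(1) by (simp add: P_def)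
    then show "\<exists>r. P f k r" ..
  qed
  then obtain f where f: "\<And>k. P f k (f k)" by blast
  have "\<bar>a k\<bar> \<le> 4 * norm (\<Sum>j\<in>A. a j *\<^sub>R d j (f j))" if A: "finite A" "k \<in> A" for A a k
  proof -
    obtain n where n: "A \<subseteq> {..<n}" using A(1) finite_nat_iff_bounded by blast
    have "(\<Sum>j\<in>A. a j *\<^sub>R d j (f j)) = (\<Sum>j<n. (if j \<in> A then a j else 0) *\<^sub>R d j (f j))"
      by (rule sum.mono_neutral_cong_left) (use n in auto)
    moreover have "\<bar>a k\<bar> \<le> 4 * norm (\<Sum>j<n. (if j \<in> A then a j else 0) *\<^sub>R d j (f j))"
      using bound[OF f, of k n "\<lambda>j. if j \<in> A then a j else 0"] A n by auto
    ultimately show ?thesis by simp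
  qed
  then show ?thesis
    by (intro exI[of _ "fst \<circ> f"] exI[of _ "snd \<circ> f"]) (auto simp: d_def)
qed

section \<open>Distance to a subspace and separated sequences\<close>

lemma exists_dist_less:
  assumes "H \<noteq> {}" "infdist v H < r"
  shows "\<exists>h\<in>H. dist v h < r"
proof (rule ccontr)
  assume "\<not> ?thesis"
  then have "r \<le> infdist v H"
    unfolding infdist_notempty[OF assms(1)] by (intro cINF_greatest[OF assms(1)]) (auto simp: not_less)
  then show False using assms(2) by simp
qed

text \<open>With the next two lemmas, the distance to \<open>H\<close> becomes usable as the
  quotient seminorm modulo \<open>H\<close>. Here almost optimal approximants are added.\<close>

lemma infdist_subspace_add:
  fixes x y :: "'a::real_normed_vector"
  assumes "subspace H"
  shows "infdist (x + y) H \<le> infdist x H + infdist y H"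
proof (rule field_le_epsilon)
  fix e :: real assume e: "0 < e"
  have ne: "H \<noteq> {}" using subspace_0[OF assms] by auto
  have "\<exists>h\<in>H. dist v h < infdist v H + e / 2" for v :: 'a
    using e by (intro exists_dist_less[OF ne]) simp
  then obtain h k where hk: "h \<in> H" "dist x h < infdist x H + e / 2" "k \<in> H" "dist y k < infdist y H + e / 2"
    by metis
  have "infdist (x + y) H \<le> dist (x + y) (h + k)"
    by (rule infdist_le) (use assms hk in \<open>simp add: subspace_add\<close>)
  also have "\<dots> \<le> dist x h + dist y k" by (rule dist_triangle_add)
  finally show "infdist (x + y) H \<le> infdist x H + infdist y H + e" using hk by simp
qed

lemma infdist_subspace_scaleR:
  fixes x :: "'a::real_normed_vector"
  assumes "subspace H"
  shows "infdist (c *\<^sub>R x) H = \<bar>c\<bar> * infdist x H"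
proof -
  have ne: "H \<noteq> {}" using subspace_0[OF assms] by auto
  have le: "infdist (c *\<^sub>R x) H \<le> \<bar>c\<bar> * infdist x H" if "c \<noteq> 0" for c and x :: 'a
  proof -
    have "infdist (c *\<^sub>R x) H / \<bar>c\<bar> \<le> infdist x H"
      unfolding infdist_notempty[OF ne, of x]
    proof (rule cINF_greatest[OF ne])
      fix h assume "h \<in> H"
      then have "infdist (c *\<^sub>R x) H \<le> norm (c *\<^sub>R (x - h))"
        by (metis infdist_le subspace_scale[OF assms] dist_norm scaleR_right_diff_distrib)
      then have "infdist (c *\<^sub>R x) H \<le> \<bar>c\<bar> * dist x h"
        by (metis norm_scaleR dist_norm)
      then show "infdist (c *\<^sub>R x) H / \<bar>c\<bar> \<le> dist x h"
        using that by (simp add: pos_divide_le_eq mult.commute)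
    qed
    then show ?thesis using that by (simp add: pos_divide_le_eq mult.commute)
  qed
  show ?thesis
  proof (cases "c = 0")
    case True
    then show ?thesis using subspace_0[OF assms] by simp
  next
    case False
    from le[of "1 / c" "c *\<^sub>R x"] False have "\<bar>c\<bar> * infdist x H \<le> infdist (c *\<^sub>R x) H"
      by (simp add: field_simps)
    with le[OF False, of x] show ?thesis by simp
  qed
qed

lemma infdist_subspace_shift:
  fixes x :: "'a::real_normed_vector"
  assumes "subspace H" "h \<in> H"
  shows "infdist (x + h) H = infdist x H"
  using infdist_subspace_add[OF assms(1), of x h] infdist_subspace_add[OF assms(1), of "x + h" "- h"]
    assms by (simp add: subspace_neg)

text \<open>A new vector \<open>z\<close> outside the closed span of \<open>B\<close> has positive
  distance from it. This distance controls the coefficient of \<open>z\<close>, so along a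
  convergent sequence these coefficients are Cauchy and the remainders converge inside
  \<open>span B\<close>.\<close>

lemma closed_span_finite:
  fixes B :: "'a::real_normed_vector set"
  assumes "finite B"
  shows "closed (span B)"
  using assms
proof induction
  case (insert z B)
  show ?case
  proof (cases "z \<in> span B")
    case True
    then show ?thesis using insert by (simp add: span_redundant)
  next
    case False
    define \<delta> where "\<delta> = infdist z (span B)"
    have \<delta>: "0 < \<delta>"
      unfolding \<delta>_def using insert False by (intro infdist_pos_not_in_closed) (auto intro: span_zero)
    have ge: "\<bar>t\<bar> * \<delta> \<le> norm (g + t *\<^sub>R z)" if "g \<in> span B" for g t
    proof -
      have "\<bar>t\<bar> * \<delta> = infdist (t *\<^sub>R z + g) (span B)"
        using infdist_subspace_shift[OF subspace_span that] infdist_subspace_scaleR[OF subspace_span]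
        by (metis \<delta>_def)
      also have "\<dots> \<le> dist (t *\<^sub>R z + g) 0" by (rule infdist_le) (rule span_zero)
      finally show ?thesis by (simp add: add.commute)
    qed
    show ?thesis unfolding closed_sequential_limits
    proof (intro allI impI, elim conjE)
      fix x l assume x: "\<forall>n. x n \<in> span (insert z B)" and l: "x \<longlonglongrightarrow> l"
      from x have "\<forall>n. \<exists>t. x n - t *\<^sub>R z \<in> span B" by (simp add: span_breakdown_eq)
      then obtain t where t: "\<And>n. x n - t n *\<^sub>R z \<in> span B" by metis
      have "Cauchy x" using l by (rule LIMSEQ_imp_Cauchy)
      have "Cauchy t"
      proof (rule metric_CauchyI)
        fix e :: real assume "0 < e"
        then obtain M where M: "\<And>m n. m \<ge> M \<Longrightarrow> n \<ge> M \<Longrightarrow> dist (x m) (x n) < e * \<delta>"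
          using \<open>Cauchy x\<close> \<delta> metric_CauchyD[of x "e * \<delta>"] by auto
        have "dist (t m) (t n) < e" if "m \<ge> M" "n \<ge> M" for m n
        proof -
          have "\<bar>t m - t n\<bar> * \<delta> \<le> norm (((x m - t m *\<^sub>R z) - (x n - t n *\<^sub>R z)) + (t m - t n) *\<^sub>R z)"
            by (intro ge span_diff[OF t t])
          also have "\<dots> = dist (x m) (x n)" by (simp add: dist_norm algebra_simps)
          also have "\<dots> < e * \<delta>" using M that by blast
          finally show ?thesis using \<delta> by (simp add: dist_norm)
        qed
        then show "\<exists>M. \<forall>m\<ge>M. \<forall>n\<ge>M. dist (t m) (t n) < e" by blast
      qed
      then obtain c where c: "t \<longlonglongrightarrow> c" using Cauchy_convergent_iff convergent_def by blast
      have "(\<lambda>n. x n - t n *\<^sub>R z) \<longlonglongrightarrow> l - c *\<^sub>R z" using l c by (intro tendsto_intros)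
      then have "l - c *\<^sub>R z \<in> span B"
        by (rule closed_sequentially[OF insert.IH t])
      then show "l \<in> span (insert z B)" by (auto simp: span_breakdown_eq)
    qed
  qed
qed simp

text \<open>Riesz's lemma, applied recursively to the closed span of the earlier vectors. An
  approximant within twice the distance replaces a nearest point, whence the bound 2.\<close>

lemma exists_bounded_separated_sequence:
  assumes "infinite_dimensional TYPE('a::real_normed_vector)"
  shows "\<exists>w :: nat \<Rightarrow> 'a. (\<forall>i. norm (w i) \<le> 2) \<and> (\<forall>i j. i \<noteq> j \<longrightarrow> 1 \<le> norm (w i - w j))"
proof -
  define P where "P f n (x :: 'a) \<longleftrightarrow> norm x \<le> 2 \<and> (\<forall>i<n. 1 \<le> norm (x - f i))" for f and n :: nat and x
  have "\<exists>w. \<forall>n. P w n (w n)"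
  proof (rule dependent_wellorder_choice)
    fix n :: nat and f :: "nat \<Rightarrow> 'a"
    let ?H = "span (f ` {..<n})"
    obtain v where v: "v \<notin> ?H"
      using assms unfolding infinite_dimensional_def by blast
    have ne: "?H \<noteq> {}" using span_zero by blast
    define \<delta> where "\<delta> = infdist v ?H"
    have \<delta>: "0 < \<delta>" unfolding \<delta>_def
      by (rule infdist_pos_not_in_closed[OF closed_span_finite ne v]) simp
    have "\<exists>h\<in>?H. dist v h < 2 * \<delta>"
      by (rule exists_dist_less) (use ne \<delta> in \<open>auto simp: \<delta>_def\<close>)
    then obtain h where h: "h \<in> ?H" "norm (v - h) < 2 * \<delta>" by (auto simp: dist_norm)
    have "1 \<le> norm ((1 / \<delta>) *\<^sub>R (v - h) - f i)" if "i < n" for i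
    proof -
      have "h + \<delta> *\<^sub>R f i \<in> ?H" using that by (intro span_add[OF h(1)] span_scale span_base) auto
      then have "\<delta> \<le> norm (v - (h + \<delta> *\<^sub>R f i))"
        unfolding \<delta>_def using infdist_le dist_norm by metis
      also have "v - (h + \<delta> *\<^sub>R f i) = \<delta> *\<^sub>R ((1 / \<delta>) *\<^sub>R (v - h) - f i)"
        using \<delta> by (simp add: scaleR_diff_right)
      finally show ?thesis using \<delta> by simp
    qed
    moreover have "norm ((1 / \<delta>) *\<^sub>R (v - h)) \<le> 2" using h(2) \<delta>
      by (simp add: pos_divide_le_eq del: scaleR_right_diff_distrib)
    ultimately show "\<exists>x. P f n x" unfolding P_def by blast
  qed (simp add: P_def)
  then obtain w where w: "\<And>n. P w n (w n)" by blast
  have "1 \<le> norm (w i - w j)" if "i \<noteq> j" for i j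
    using w[of i] w[of j] that unfolding P_def by (metis linorder_neqE_nat norm_minus_commute)
  then show ?thesis using w unfolding P_def by blast
qed

section \<open>Coordinate seminorms and renorming\<close>

definition seminorm :: "('a::real_vector \<Rightarrow> real) \<Rightarrow> bool" where
  "seminorm q \<longleftrightarrow> (\<forall>x y. q (x + y) \<le> q x + q y) \<and> (\<forall>c x. q (c *\<^sub>R x) = \<bar>c\<bar> * q x)"

lemma seminorm_Sup:
  assumes Q: "Q \<noteq> {}" "\<And>q. q \<in> Q \<Longrightarrow> seminorm q" "\<And>v. bdd_above ((\<lambda>q. q v) ` Q)"
  shows "seminorm (\<lambda>v. SUP q\<in>Q. q v)"
proof -
  let ?N = "\<lambda>v. SUP q\<in>Q. q v"
  have up: "q v \<le> ?N v" if "q \<in> Q" for q v using cSUP_upper[OF that Q(3)] .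
  have add: "?N (x + y) \<le> ?N x + ?N y" for x y
  proof (rule cSUP_least[OF Q(1)])
    fix q assume q: "q \<in> Q"
    have "q (x + y) \<le> q x + q y" using Q(2)[OF q] by (simp add: seminorm_def)
    also have "\<dots> \<le> ?N x + ?N y" using up[OF q] by (intro add_mono)
    finally show "q (x + y) \<le> ?N x + ?N y" .
  qed
  have le: "?N (c *\<^sub>R x) \<le> \<bar>c\<bar> * ?N x" for c x
  proof (rule cSUP_least[OF Q(1)])
    fix q assume q: "q \<in> Q"
    then show "q (c *\<^sub>R x) \<le> \<bar>c\<bar> * ?N x"
      using Q(2)[OF q] up[OF q, of x] by (simp add: seminorm_def mult_left_mono)
  qed
  have "?N (c *\<^sub>R x) = \<bar>c\<bar> * ?N x" for c x
  proof (cases "c = 0")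
    case True
    obtain q where q: "q \<in> Q" using Q(1) by blast
    have "q 0 = \<bar>0\<bar> * q 0" using Q(2)[OF q] unfolding seminorm_def by (metis scaleR_zero_left)
    then have "0 \<le> ?N 0" using up[OF q, of 0] by simp
    then show ?thesis using le[of 0 x] True by simp
  next
    case False
    have "?N x \<le> \<bar>1 / c\<bar> * ?N (c *\<^sub>R x)" using le[of "1 / c" "c *\<^sub>R x"] False by simp
    then have "\<bar>c\<bar> * ?N x \<le> ?N (c *\<^sub>R x)" using False by (simp add: field_simps)
    then show ?thesis using le[of c x] by simp
  qed
  with add show ?thesis by (simp add: seminorm_def)
qed

text \<open>The distance to the span of the other vectors replaces a Hahn-Banach extension of the
  coordinate functional.\<close>

lemma coordinate_seminorm:
  fixes z :: "'i \<Rightarrow> 'a::real_normed_vector"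
  assumes low: "\<And>A a p. finite A \<Longrightarrow> p \<in> A \<Longrightarrow> \<bar>a p\<bar> \<le> C * norm (\<Sum>r\<in>A. a r *\<^sub>R z r)" and C: "0 < C"
  shows "\<exists>q. seminorm q \<and> (\<forall>v. q v \<le> C * norm v) \<and>
    (\<forall>A a. finite A \<longrightarrow> q (\<Sum>r\<in>A. a r *\<^sub>R z r) = (if p \<in> A then \<bar>a p\<bar> else 0))"
proof -
  define H where "H = span (z ` (- {p}))"
  have H: "subspace H" "H \<noteq> {}" "0 \<in> H" by (auto simp: H_def span_zero intro: span_zero)
  have away: "\<bar>a p\<bar> \<le> C * norm ((\<Sum>r\<in>A. a r *\<^sub>R z r) + h)" if "h \<in> H" "finite A" "p \<in> A" for h A a
    using that unfolding H_def
  proof (induction arbitrary: A a rule: span_induct_alt)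
    case base
    then show ?case using low by simp
  next
    case (step c v y)
    then obtain r where r: "v = z r" "r \<noteq> p" by auto
    \<comment> \<open>The generator \<open>c *\<^sub>R z r\<close> is absorbed into the combination
      over \<open>A\<close>; as \<open>r\<close> differs from \<open>p\<close>, the coefficient at
      \<open>p\<close> is untouched.\<close>
    let ?a = "\<lambda>i. (if i \<in> A then a i else 0) + (if i = r then c else 0)"
    have "(\<Sum>i\<in>insert r A. ?a i *\<^sub>R z i)
        = (\<Sum>i\<in>insert r A. (if i \<in> A then a i else 0) *\<^sub>R z i) + (\<Sum>i\<in>insert r A. (if i = r then c else 0) *\<^sub>R z i)"
      by (simp add: scaleR_add_left sum.distrib)
    also have "(\<Sum>i\<in>insert r A. (if i \<in> A then a i else 0) *\<^sub>R z i) = (\<Sum>i\<in>A. a i *\<^sub>R z i)"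
      by (rule sum.mono_neutral_cong_right) (use step in auto)
    also have "(\<Sum>i\<in>insert r A. (if i = r then c else 0) *\<^sub>R z i) = (\<Sum>i\<in>{r}. c *\<^sub>R z i)"
      by (rule sum.mono_neutral_cong_right) (use step in auto)
    finally have "(\<Sum>i\<in>insert r A. ?a i *\<^sub>R z i) + y = (\<Sum>i\<in>A. a i *\<^sub>R z i) + (c *\<^sub>R v + y)"
      using r by (simp add: add.assoc)
    moreover have "\<bar>?a p\<bar> \<le> C * norm ((\<Sum>i\<in>insert r A. ?a i *\<^sub>R z i) + y)"
      by (rule step.IH) (use step in auto)
    ultimately show ?case using r step.prems by (simp add: add.assoc)
  qed
  define \<delta> where "\<delta> = infdist (z p) H"
  have "1 / C \<le> \<delta>" unfolding \<delta>_def infdist_notempty[OF H(2)]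
  proof (rule cINF_greatest[OF H(2)])
    fix h assume "h \<in> H"
    then have "- h \<in> H" using H by (simp add: subspace_neg)
    from away[OF this, of "{p}" "\<lambda>_. 1"] show "1 / C \<le> dist (z p) h"
      using C by (simp add: dist_norm field_simps)
  qed
  then have \<delta>: "0 < \<delta>" "1 \<le> C * \<delta>" using C by (auto simp: field_simps intro: less_le_trans[of _ "1 / C"])
  \<comment> \<open>Division by \<open>\<delta>\<close> gives \<open>z p\<close> the value 1, and
    \<open>1 \<le> C * \<delta>\<close> yields the bound by \<open>C * norm v\<close>.\<close>
  define q where "q v = infdist v H / \<delta>" for v
  have "seminorm q"
    using infdist_subspace_add[OF H(1)] infdist_subspace_scaleR[OF H(1)] \<delta>
    by (auto simp: seminorm_def q_def divide_right_mono simp flip: add_divide_distrib)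
  moreover have "q v \<le> C * norm v" for v
  proof -
    have "infdist v H \<le> norm v" using infdist_le[OF H(3), of v] by simp
    also have "\<dots> \<le> (C * \<delta>) * norm v" using mult_right_mono[OF \<delta>(2) norm_ge_zero[of v]] by simp
    finally show ?thesis using \<delta>(1) by (simp add: q_def pos_divide_le_eq mult_ac)
  qed
  moreover have "q (\<Sum>r\<in>A. a r *\<^sub>R z r) = (if p \<in> A then \<bar>a p\<bar> else 0)" if A: "finite A" for A a
  proof -
    have rest: "(\<Sum>r\<in>A - {p}. a r *\<^sub>R z r) \<in> H"
      unfolding H_def by (intro span_sum span_scale span_base) auto
    show ?thesis
    proof (cases "p \<in> A")
      case True
      then have "infdist (\<Sum>r\<in>A. a r *\<^sub>R z r) H = infdist (a p *\<^sub>R z p) H"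
        using infdist_subspace_shift[OF H(1) rest, of "a p *\<^sub>R z p"] by (simp add: sum.remove[OF A])
      then show ?thesis using True \<delta> infdist_subspace_scaleR[OF H(1)] by (simp add: q_def \<delta>_def)
    next
      case False
      then show ?thesis using rest by (simp add: q_def)
    qed
  qed
  ultimately show ?thesis by blast
qed

text \<open>In the new norm \<open>N\<close> the coordinate seminorms are bounded by
  \<open>N\<close> and the prescribed sums have \<open>N\<close> at most 1. An embedding
  \<open>T\<close> of the renormed space transfers both facts to the vectors \<open>T (z r)\<close>.
  The resulting constants no longer involve \<open>C\<close> and \<open>M\<close>, so the
  construction can be iterated.\<close>

lemma elastic_renorming:
  fixes z :: "'i \<Rightarrow> 'a::banach"
  assumes el: "K_elastic K TYPE('a)" and C: "0 < C"
    and low: "\<And>A a p. finite A \<Longrightarrow> p \<in> A \<Longrightarrow> \<bar>a p\<bar> \<le> C * norm (\<Sum>r\<in>A. a r *\<^sub>R z r)"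
    and fin: "\<And>A. A \<in> \<A> \<Longrightarrow> finite A"
    and up: "\<And>A a. A \<in> \<A> \<Longrightarrow> \<forall>r\<in>A. \<bar>a r\<bar> \<le> 1 \<Longrightarrow> norm (\<Sum>r\<in>A. a r *\<^sub>R z r) \<le> M"
  shows "\<exists>x :: 'i \<Rightarrow> 'a. (\<forall>A a. finite A \<longrightarrow> (\<forall>p\<in>A. \<bar>a p\<bar> \<le> norm (\<Sum>r\<in>A. a r *\<^sub>R x r))) \<and>
    (\<forall>A a. A \<in> \<A> \<longrightarrow> (\<forall>r\<in>A. \<bar>a r\<bar> \<le> 1) \<longrightarrow> norm (\<Sum>r\<in>A. a r *\<^sub>R x r) \<le> \<bar>K\<bar>)"
proof -
  \<comment> \<open>The gauge of the ball generated by \<open>W\<close> and the ball of radius \<open>1 / C\<close>, described as the largest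
    seminorm that is at most \<open>1\<close> on both.\<close>
  define W where "W = {(\<Sum>r\<in>A. a r *\<^sub>R z r) | A a. A \<in> \<A> \<and> (\<forall>r\<in>A. \<bar>a r\<bar> \<le> 1)}"
  define Q where "Q = {q. seminorm q \<and> (\<forall>v. q v \<le> C * norm v) \<and> (\<forall>w\<in>W. q w \<le> 1)}"
  define N where "N v = (SUP q\<in>Q. q v)" for v
  \<comment> \<open>The lower bounds \<open>M\<close> and \<open>1 / C\<close> on \<open>m\<close>
    put \<open>norm v / m\<close> into \<open>Q\<close>, which makes \<open>N\<close> equivalent to
    the norm.\<close>
  define m where "m = max \<bar>M\<bar> (max 1 (1 / C))"
  have m: "M \<le> m" "0 < m" "1 / C \<le> m" by (auto simp: m_def)
  have q0: "(\<lambda>v. norm v / m) \<in> Q"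
  proof -
    have "seminorm (\<lambda>v::'a. norm v / m)"
      using m by (auto simp: seminorm_def intro!: divide_right_mono norm_triangle_ineq simp flip: add_divide_distrib)
    moreover have "norm v / m \<le> C * norm v" for v :: 'a
    proof -
      have "1 \<le> C * m" using m C by (simp add: field_simps)
      from mult_right_mono[OF this norm_ge_zero[of v]] show ?thesis
        using m by (simp add: pos_divide_le_eq mult_ac)
    qed
    moreover have "norm w / m \<le> 1" if "w \<in> W" for w
    proof -
      have "norm w \<le> M" using that up by (auto simp: W_def)
      then show ?thesis using m by simp
    qed
    ultimately show ?thesis by (simp add: Q_def)
  qed
  have bdd: "bdd_above ((\<lambda>q. q v) ` Q)" for v
    by (rule bdd_aboveI[of _ "C * norm v"]) (auto simp: Q_def)
  have ne: "Q \<noteq> {}" using q0 by blast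
  have le_N: "q v \<le> N v" if "q \<in> Q" for q v unfolding N_def by (rule cSUP_upper[OF that bdd])
  have "seminorm N" unfolding N_def by (rule seminorm_Sup) (use ne bdd in \<open>auto simp: Q_def\<close>)
  moreover have "N v \<le> C * norm v" for v unfolding N_def by (rule cSUP_least[OF ne]) (simp add: Q_def)
  moreover have "(1 / m) * norm v \<le> N v" for v using le_N[OF q0, of v] by simp
  ultimately have "equiv_norm_on UNIV N"
    unfolding equiv_norm_on_def seminorm_def using C m
    by (intro conjI exI[of _ "1 / m"] exI[of _ C]) auto
  \<comment> \<open>Elasticity is applied to the whole space with the norm \<open>N\<close>.\<close>
  then have "K_embeds K UNIV N TYPE('a)"
    using el unfolding K_elastic_def by (metis closed_UNIV subspace_UNIV)
  then obtain T :: "'a \<Rightarrow> 'a" where T: "linear_on_set UNIV T" "\<And>y. N y \<le> norm (T y)" "\<And>y. norm (T y) \<le> K * N y"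
    unfolding K_embeds_def by blast
  have "linear T" using T(1) by (intro linearI) (auto simp: linear_on_set_def)
  then have Tsum: "(\<Sum>r\<in>A. a r *\<^sub>R T (z r)) = T (\<Sum>r\<in>A. a r *\<^sub>R z r)" for A a
    by (simp add: linear_sum linear_scale)
  have "\<bar>a p\<bar> \<le> norm (\<Sum>r\<in>A. a r *\<^sub>R T (z r))" if A: "finite A" "p \<in> A" for A a p
  proof -
    obtain q where q: "seminorm q" "\<And>v. q v \<le> C * norm v"
      "\<And>A a. finite A \<Longrightarrow> q (\<Sum>r\<in>A. a r *\<^sub>R z r) = (if p \<in> A then \<bar>a p\<bar> else 0)"
      using coordinate_seminorm[of C z p, OF low C] by blast
    \<comment> \<open>On a sum in \<open>W\<close> the coordinate seminorm is the modulus of one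
      coefficient or 0. Hence it competes in the supremum defining \<open>N\<close> and survives the
      renorming.\<close>
    have "q w \<le> 1" if "w \<in> W" for w using that q(3) fin by (auto simp: W_def)
    then have "q \<in> Q" using q by (simp add: Q_def)
    from le_N[OF this, of "\<Sum>r\<in>A. a r *\<^sub>R z r"] q(3)[OF A(1), of a] A(2) T(2)[of "\<Sum>r\<in>A. a r *\<^sub>R z r"]
    show ?thesis by (simp add: Tsum)
  qed
  moreover have "norm (\<Sum>r\<in>A. a r *\<^sub>R T (z r)) \<le> \<bar>K\<bar>" if A: "A \<in> \<A>" "\<forall>r\<in>A. \<bar>a r\<bar> \<le> 1" for A a
  proof -
    let ?w = "\<Sum>r\<in>A. a r *\<^sub>R z r"
    have "?w \<in> W" using A by (auto simp: W_def)
    then have "N ?w \<le> 1" unfolding N_def by (intro cSUP_least[OF ne]) (simp add: Q_def)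
    moreover have "0 \<le> N ?w" using le_N[OF q0, of ?w] m by (smt (verit) divide_nonneg_pos norm_ge_zero)
    ultimately have "\<bar>K\<bar> * N ?w \<le> \<bar>K\<bar>" by (simp add: mult_left_le)
    moreover have "K * N ?w \<le> \<bar>K\<bar> * N ?w" using \<open>0 \<le> N ?w\<close> by (intro mult_right_mono) auto
    ultimately show ?thesis using T(3)[of ?w] unfolding Tsum by linarith
  qed
  ultimately show ?thesis by (intro exI[of _ "\<lambda>r. T (z r)"]) blast
qed

section \<open>Finite sequences like the basis of c0, and their limits\<close>

text \<open>The lower constant 2, instead of 1, leaves room for approximating the vectors by a dense
  sequence.\<close>

definition c0_like :: "real \<Rightarrow> (nat \<Rightarrow> 'a::real_normed_vector) \<Rightarrow> nat \<Rightarrow> bool" where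
  "c0_like M b n \<longleftrightarrow> (\<forall>a. (\<forall>i<n. \<bar>a i\<bar> \<le> 2 * norm (\<Sum>i<n. a i *\<^sub>R b i)) \<and>
     ((\<forall>i<n. \<bar>a i\<bar> \<le> 1) \<longrightarrow> norm (\<Sum>i<n. a i *\<^sub>R b i) \<le> M))"

lemma c0_like_cong:
  assumes "\<And>i. i < n \<Longrightarrow> b i = c i"
  shows "c0_like M b n \<longleftrightarrow> c0_like M c n"
proof -
  have "(\<Sum>i<n. a i *\<^sub>R b i) = (\<Sum>i<n. a i *\<^sub>R c i)" for a using assms by simp
  then show ?thesis by (simp add: c0_like_def)
qed

lemma c0_like_mono:
  assumes "c0_like M b n" "m \<le> n"
  shows "c0_like M b m"
  unfolding c0_like_def
proof (intro allI conjI impI)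
  fix a :: "nat \<Rightarrow> real"
  let ?a = "\<lambda>i. if i < m then a i else 0"
  have eq: "(\<Sum>i<n. ?a i *\<^sub>R b i) = (\<Sum>i<m. a i *\<^sub>R b i)"
    by (rule sum.mono_neutral_cong_right) (use assms(2) in auto)
  have *: "(\<forall>i<n. \<bar>?a i\<bar> \<le> 2 * norm (\<Sum>i<n. ?a i *\<^sub>R b i)) \<and>
     ((\<forall>i<n. \<bar>?a i\<bar> \<le> 1) \<longrightarrow> norm (\<Sum>i<n. ?a i *\<^sub>R b i) \<le> M)"
    using assms(1)[unfolded c0_like_def, THEN spec, of ?a] .
  show "\<bar>a i\<bar> \<le> 2 * norm (\<Sum>i<m. a i *\<^sub>R b i)" if "i < m" for i
    using *[THEN conjunct1, THEN spec, of i] that assms(2) unfolding eq by simp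
  show "norm (\<Sum>i<m. a i *\<^sub>R b i) \<le> M" if "\<forall>i<m. \<bar>a i\<bar> \<le> 1"
    using *[THEN conjunct2] that unfolding eq by simp
qed

text \<open>If \<open>r\<close> is the largest modulus of a coefficient, the perturbation moves the
  sum by at most \<open>r / 2\<close>, while the original sum has norm at least
  \<open>r\<close>.\<close>

lemma c0_like_perturb:
  fixes b x :: "nat \<Rightarrow> 'a::real_normed_vector"
  assumes low: "\<And>a i. i < n \<Longrightarrow> \<bar>a i\<bar> \<le> norm (\<Sum>i<n. a i *\<^sub>R x i)"
    and up: "\<And>a. \<forall>i<n. \<bar>a i\<bar> \<le> 1 \<Longrightarrow> norm (\<Sum>i<n. a i *\<^sub>R x i) \<le> M"
    and close: "\<And>i. i < n \<Longrightarrow> norm (b i - x i) \<le> (1 / 2) ^ (i + 2)"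
  shows "c0_like (M + 1) b n"
proof -
  have geo: "(\<Sum>i<n. (1 / 2 :: real) ^ (i + 2)) \<le> 1 / 2"
  proof -
    have "(\<Sum>i<n. (1 / 2 :: real) ^ (i + 2)) = 1 / 2 - (1 / 2) ^ (n + 1)"
      by (induction n) (auto simp: field_simps)
    then show ?thesis by simp
  qed
  have diff: "norm ((\<Sum>i<n. a i *\<^sub>R b i) - (\<Sum>i<n. a i *\<^sub>R x i)) \<le> r / 2"
    if r: "\<And>i. i < n \<Longrightarrow> \<bar>a i\<bar> \<le> r" "0 \<le> r" for a r
  proof -
    have "(\<Sum>i<n. a i *\<^sub>R b i) - (\<Sum>i<n. a i *\<^sub>R x i) = (\<Sum>i<n. a i *\<^sub>R (b i - x i))"
      by (simp add: scaleR_diff_right sum_subtractf)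
    also have "norm \<dots> \<le> (\<Sum>i<n. r * (1 / 2) ^ (i + 2))"
    proof (rule sum_norm_le)
      fix i assume "i \<in> {..<n}"
      then have "\<bar>a i\<bar> * norm (b i - x i) \<le> r * (1 / 2) ^ (i + 2)"
        using r close by (intro mult_mono) auto
      then show "norm (a i *\<^sub>R (b i - x i)) \<le> r * (1 / 2) ^ (i + 2)"
        by (simp del: scaleR_right_diff_distrib)
    qed
    also have "\<dots> = r * (\<Sum>i<n. (1 / 2) ^ (i + 2))" by (simp add: sum_distrib_left)
    also have "\<dots> \<le> r * (1 / 2)" using geo r(2) by (rule mult_left_mono)
    finally show ?thesis by simp
  qed
  show ?thesis unfolding c0_like_def
  proof (intro allI conjI impI)
    fix a :: "nat \<Rightarrow> real" and i assume i: "i < n"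
    define r where "r = Max ((\<lambda>i. \<bar>a i\<bar>) ` {..<n})"
    have "r \<in> (\<lambda>i. \<bar>a i\<bar>) ` {..<n}" unfolding r_def by (rule Max_in) (use i in auto)
    then obtain k where k: "k < n" "r = \<bar>a k\<bar>" by auto
    have r: "\<bar>a j\<bar> \<le> r" if "j < n" for j unfolding r_def by (rule Max_ge) (use that in auto)
    have "r \<le> norm (\<Sum>i<n. a i *\<^sub>R x i)" using low[OF k(1), of a] k(2) by simp
    moreover have "norm ((\<Sum>i<n. a i *\<^sub>R b i) - (\<Sum>i<n. a i *\<^sub>R x i)) \<le> r / 2"
      using r k by (intro diff) auto
    ultimately have "r \<le> 2 * norm (\<Sum>i<n. a i *\<^sub>R b i)"
      using norm_triangle_ineq2[of "\<Sum>i<n. a i *\<^sub>R x i" "\<Sum>i<n. a i *\<^sub>R b i"]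
      by (simp add: norm_minus_commute)
    then show "\<bar>a i\<bar> \<le> 2 * norm (\<Sum>i<n. a i *\<^sub>R b i)" using r[OF i] by simp
  next
    fix a :: "nat \<Rightarrow> real" assume a: "\<forall>i<n. \<bar>a i\<bar> \<le> 1"
    then show "norm (\<Sum>i<n. a i *\<^sub>R b i) \<le> M + 1"
      using up[OF a] diff[of a 1] norm_triangle_ineq2[of "\<Sum>i<n. a i *\<^sub>R b i" "\<Sum>i<n. a i *\<^sub>R x i"] by simp
  qed
qed

text \<open>The upper estimate, scaled to small coefficients, makes the series with coefficients in
  \<open>c0\<close> Cauchy; both estimates then pass to the limit.\<close>

lemma contains_c0_if_c0_like:
  fixes b :: "nat \<Rightarrow> 'a::banach"
  assumes b: "\<And>n. c0_like M b n" and M: "0 < M"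
  shows "contains_c0 TYPE('a)"
proof -
  have low: "\<bar>a i\<bar> \<le> 2 * norm (\<Sum>i<n. a i *\<^sub>R b i)" if "i < n" for a i n
    using b[of n] that by (simp add: c0_like_def)
  have up: "norm (\<Sum>i<n. a i *\<^sub>R b i) \<le> M * r" if a: "\<And>i. i < n \<Longrightarrow> \<bar>a i\<bar> \<le> r" and r: "0 < r" for a n r
  proof -
    have "norm (\<Sum>i<n. (a i / r) *\<^sub>R b i) \<le> M"
      using b[of n] a r unfolding c0_like_def by (auto simp: field_simps)
    moreover have "(\<Sum>i<n. (a i / r) *\<^sub>R b i) = (1 / r) *\<^sub>R (\<Sum>i<n. a i *\<^sub>R b i)"
      by (simp add: scaleR_sum_right)
    ultimately show ?thesis using r by (simp add: field_simps)
  qed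
  have sm: "summable (\<lambda>i. x i *\<^sub>R b i)" if x: "x \<in> c0" for x
    unfolding summable_Cauchy
  proof (intro allI impI)
    fix e :: real assume e: "0 < e"
    define r where "r = e / (2 * M)"
    have r: "0 < r" "M * r < e" using e M by (auto simp: r_def)
    have "x \<longlonglongrightarrow> 0" using x by (simp add: c0_def)
    then obtain k where k: "\<And>i. i \<ge> k \<Longrightarrow> \<bar>x i\<bar> < r"
      using r(1) unfolding LIMSEQ_def by (metis dist_0_norm dist_commute real_norm_def)
    have "norm (\<Sum>i = m..<n. x i *\<^sub>R b i) < e" if "m \<ge> k" for m n
    proof -
      have "(\<Sum>i = m..<n. x i *\<^sub>R b i) = (\<Sum>i<n. (if m \<le> i then x i else 0) *\<^sub>R b i)"
        by (rule sum.mono_neutral_cong_left) auto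
      also have "norm \<dots> \<le> M * r"
        using k that r by (intro up) (auto intro: less_imp_le order_trans)
      finally show ?thesis using r by simp
    qed
    then show "\<exists>N. \<forall>m\<ge>N. \<forall>n. norm (\<Sum>i = m..<n. x i *\<^sub>R b i) < e" by blast
  qed
  define T where "T x = (\<Sum>i. x i *\<^sub>R b i)" for x
  have lim: "(\<lambda>n. \<Sum>i<n. x i *\<^sub>R b i) \<longlonglongrightarrow> T x" if "x \<in> c0" for x
    unfolding T_def using summable_LIMSEQ[OF sm[OF that]] .
  have le_norm: "\<bar>x n\<bar> \<le> c0_norm x" if "x \<in> c0" for x n
  proof -
    have "Bseq x" using that by (auto simp: c0_def intro: convergent_imp_Bseq convergentI)
    then obtain B where "\<And>n. \<bar>x n\<bar> \<le> B" by (auto simp: Bseq_def)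
    then have "bdd_above (range (\<lambda>n. \<bar>x n\<bar>))" by (intro bdd_aboveI[of _ B]) auto
    then show ?thesis unfolding c0_norm_def by (intro cSUP_upper) auto
  qed
  have upT: "norm (T x) \<le> M * c0_norm x" if x: "x \<in> c0" for x
  proof (rule field_le_epsilon)
    fix e :: real assume e: "0 < e"
    \<comment> \<open>The scaled estimate \<open>up\<close> needs a positive bound, but
      \<open>c0_norm x\<close> may be 0.\<close>
    have eM: "0 < e / M" using e M by simp
    have "\<bar>x i\<bar> \<le> c0_norm x + e / M" for i using le_norm[OF x, of i] eM by linarith
    moreover have "0 < c0_norm x + e / M" using le_norm[OF x, of 0] eM by linarith
    ultimately have "norm (\<Sum>i<n. x i *\<^sub>R b i) \<le> M * (c0_norm x + e / M)" for n
      by (intro up)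
    then have "norm (T x) \<le> M * (c0_norm x + e / M)"
      using tendsto_norm[OF lim[OF x]] by (intro LIMSEQ_le_const2) auto
    then show "norm (T x) \<le> M * c0_norm x + e" using M by (simp add: distrib_left)
  qed
  have lowT: "1 / 2 * c0_norm x \<le> norm (T x)" if x: "x \<in> c0" for x
  proof -
    have "\<bar>x i\<bar> \<le> 2 * norm (T x)" for i
    proof (rule LIMSEQ_le_const)
      show "(\<lambda>n. 2 * norm (\<Sum>i<n. x i *\<^sub>R b i)) \<longlonglongrightarrow> 2 * norm (T x)"
        using lim[OF x] by (intro tendsto_intros)
      show "\<exists>N. \<forall>n\<ge>N. \<bar>x i\<bar> \<le> 2 * norm (\<Sum>i<n. x i *\<^sub>R b i)"
        using low by (intro exI[of _ "Suc i"]) auto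
    qed
    then have "c0_norm x \<le> 2 * norm (T x)" unfolding c0_norm_def by (intro cSUP_least) auto
    then show ?thesis by simp
  qed
  have "T (\<lambda>n. x n + y n) = T x + T y" if "x \<in> c0" "y \<in> c0" for x y
    unfolding T_def using suminf_add[OF sm[OF that(1)] sm[OF that(2)]] by (simp add: scaleR_add_left)
  moreover have "T (\<lambda>n. c * x n) = c *\<^sub>R T x" if "x \<in> c0" for c x
    unfolding T_def using suminf_scaleR_right[OF sm[OF that], of c] by simp
  ultimately show ?thesis
    unfolding contains_c0_def using upT lowT M
    by (intro exI[of _ T] exI[of _ "1/2"] exI[of _ M]) auto
qed

section \<open>The tree and the families of vectors on it\<close>

text \<open>Nodes are lists of indices rather than of vectors, which keeps them countable: the
  inductive step enumerates all pairs of a node and a number.\<close>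

definition c0_tree :: "(nat \<Rightarrow> 'a::real_normed_vector) \<Rightarrow> real \<Rightarrow> nat list set" where
  "c0_tree e M = {s. c0_like M (\<lambda>i. e (s ! i)) (length s)}"

lemma c0_tree_prefix:
  assumes "t \<in> c0_tree e M" "prefix s t"
  shows "s \<in> c0_tree e M"
proof -
  have "c0_like M (\<lambda>i. e (t ! i)) (length s)"
    using assms c0_like_mono prefix_length_le unfolding c0_tree_def by blast
  moreover have "t ! i = s ! i" if "i < length s" for i
    using assms(2) that by (auto simp: prefix_def nth_append)
  ultimately show ?thesis
    unfolding c0_tree_def using c0_like_cong[of "length s" "\<lambda>i. e (t ! i)" "\<lambda>i. e (s ! i)" M] by simp
qed

text \<open>An admissible set picks at most one index \<open>n\<close> at each node of a chain of nodes above \<open>s\<close>. The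
  indices at different nodes are independent of each other; this freedom allows vectors
  to be replaced by differences later on.\<close>

definition admissible :: "'d list set \<Rightarrow> 'd list \<Rightarrow> ('d list \<times> nat) set \<Rightarrow> bool" where
  "admissible \<T> s A \<longleftrightarrow> finite A \<and> (\<forall>p\<in>A. fst p \<in> \<T> \<and> prefix s (fst p)) \<and>
     (\<forall>p\<in>A. \<forall>q\<in>A. p \<noteq> q \<longrightarrow> fst p \<noteq> fst q \<and> (prefix (fst p) (fst q) \<or> prefix (fst q) (fst p)))"

text \<open>The lower estimate concerns arbitrary finite sets of pairs, the upper one only branches
  above \<open>s\<close>. Neither constant depends on \<open>s\<close>, so an induction over the
  tree can run. The modulus of \<open>K\<close> appears because its sign is not known.\<close>

definition tree_family :: "real \<Rightarrow> 'd list set \<Rightarrow> 'd list \<Rightarrow> ('d list \<times> nat \<Rightarrow> 'a::real_normed_vector) \<Rightarrow> bool" where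
  "tree_family K \<T> s x \<longleftrightarrow>
     (\<forall>A a. finite A \<longrightarrow> (\<forall>p\<in>A. \<bar>a p\<bar> \<le> norm (\<Sum>r\<in>A. a r *\<^sub>R x r))) \<and>
     (\<forall>A a. admissible \<T> s A \<longrightarrow> (\<forall>r\<in>A. \<bar>a r\<bar> \<le> 1) \<longrightarrow> norm (\<Sum>r\<in>A. a r *\<^sub>R x r) \<le> \<bar>K\<bar>)"

lemma tree_family_lower:
  "tree_family K \<T> s x \<Longrightarrow> finite A \<Longrightarrow> p \<in> A \<Longrightarrow> \<bar>a p\<bar> \<le> norm (\<Sum>r\<in>A. a r *\<^sub>R x r)"
  by (simp add: tree_family_def)

lemma tree_family_upper:
  "tree_family K \<T> s x \<Longrightarrow> admissible \<T> s A \<Longrightarrow> \<forall>r\<in>A. \<bar>a r\<bar> \<le> 1 \<Longrightarrow>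
    norm (\<Sum>r\<in>A. a r *\<^sub>R x r) \<le> \<bar>K\<bar>"
  by (simp add: tree_family_def)

lemma tree_family_upper_inj:
  assumes x: "tree_family K \<T> s x" and g: "inj_on g B" "admissible \<T> s (g ` B)"
    and a: "\<forall>r\<in>B. \<bar>a r\<bar> \<le> 1"
  shows "norm (\<Sum>r\<in>B. a r *\<^sub>R x (g r)) \<le> \<bar>K\<bar>"
proof -
  have "(\<Sum>r\<in>B. a r *\<^sub>R x (g r)) = (\<Sum>r\<in>g ` B. a (inv_into B g r) *\<^sub>R x r)"
    using g(1) by (simp add: sum.reindex)
  also have "norm \<dots> \<le> \<bar>K\<bar>"
    by (rule tree_family_upper[OF x g(2)]) (use a g(1) in auto)
  finally show ?thesis .
qed

text \<open>Nodes strictly above \<open>s\<close> take their sequences from the family of the child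
  they pass through, and \<open>s\<close> takes a separated sequence. Differences make everything
  uniformly minimal with constant 4. A branch meets only one child, so its sum is a root term plus
  two sums bounded by that child's family; \<open>elastic_renorming\<close> then restores the
  constants.\<close>

lemma tree_family_step:
  fixes s :: "'d::countable list"
  assumes el: "K_elastic K TYPE('a::banach)" and inf: "infinite_dimensional TYPE('a)"
    and closed: "\<And>s t. t \<in> \<T> \<Longrightarrow> prefix s t \<Longrightarrow> s \<in> \<T>"
    and IH: "\<And>d. s @ [d] \<in> \<T> \<Longrightarrow> \<exists>x :: 'd list \<times> nat \<Rightarrow> 'a. tree_family K \<T> (s @ [d]) x"
  shows "\<exists>x :: 'd list \<times> nat \<Rightarrow> 'a. tree_family K \<T> s x"
proof -
  obtain X :: "'d \<Rightarrow> 'd list \<times> nat \<Rightarrow> 'a" where X: "\<And>d. s @ [d] \<in> \<T> \<Longrightarrow> tree_family K \<T> (s @ [d]) (X d)"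
    using IH by metis
  obtain w0 :: "nat \<Rightarrow> 'a" where w0: "\<And>i. norm (w0 i) \<le> 2" "\<And>i j. i \<noteq> j \<Longrightarrow> 1 \<le> norm (w0 i - w0 j)"
    using exists_bounded_separated_sequence[OF inf] by blast
  define above where "above t \<longleftrightarrow> t \<in> \<T> \<and> strict_prefix s t" for t
  define child where "child t = t ! length s" for t :: "'d list"
  have child: "prefix (s @ [child t]) t" "s @ [child t] \<in> \<T>" if t: "above t" for t
  proof -
    have "strict_prefix s t" using t by (simp add: above_def)
    then obtain d u where "t = s @ d # u" by (rule strict_prefixE')
    then show pre: "prefix (s @ [child t]) t" by (simp add: child_def)
    show "s @ [child t] \<in> \<T>" by (rule closed[OF _ pre]) (use t in \<open>simp add: above_def\<close>)
  qed
  define W where "W t i = (if above t then X (child t) (t, i) else w0 i)" for t i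
  have Wb: "norm (W t i) \<le> \<bar>K\<bar> + 2" for t i
  proof (cases "above t")
    case True
    then have "admissible \<T> (s @ [child t]) {(t, i)}"
      using child by (simp add: admissible_def above_def)
    from tree_family_upper[OF X[OF child(2)[OF True]] this, of "\<lambda>_. 1"] True
    show ?thesis by (simp add: W_def)
  qed (use w0(1)[of i] in \<open>simp add: W_def\<close>)
  have Ws: "1 \<le> norm (W t i - W t j)" if "i \<noteq> j" for t i j
  proof (cases "above t")
    case True
    from tree_family_lower[OF X[OF child(2)[OF True]], of "{(t, i), (t, j)}" "(t, i)"
        "\<lambda>p. if p = (t, i) then 1 else -1"] that True
    show ?thesis by (simp add: W_def)
  qed (use w0(2)[OF that] in \<open>simp add: W_def\<close>)
  \<comment> \<open>The sequence of a node \<open>t\<close> is listed once for each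
    \<open>n\<close>, so that every pair \<open>(t, n)\<close> receives a difference of its
    own.\<close>
  define w where "w k = W (fst (from_nat k :: 'd list \<times> nat))" for k
  have "\<exists>p q. \<forall>A a. finite A \<longrightarrow>
      (\<forall>k\<in>A. \<bar>a k\<bar> \<le> 4 * norm (\<Sum>j\<in>A. a j *\<^sub>R (w j (p j) - w j (q j))))"
    unfolding w_def by (rule exists_uniformly_minimal_differences[OF Wb Ws])
  then obtain p q where pq: "\<forall>A a. finite A \<longrightarrow>
      (\<forall>k\<in>A. \<bar>a k\<bar> \<le> 4 * norm (\<Sum>j\<in>A. a j *\<^sub>R (w j (p j) - w j (q j))))" by (elim exE)
  define z where "z r = W (fst r) (p (to_nat r)) - W (fst r) (q (to_nat r))" for r :: "'d list \<times> nat"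
  have low: "\<bar>a r\<bar> \<le> 4 * norm (\<Sum>r\<in>A. a r *\<^sub>R z r)" if "finite A" "r \<in> A" for A r a
  proof -
    have "(\<Sum>j\<in>to_nat ` A. a (from_nat j) *\<^sub>R (w j (p j) - w j (q j))) = (\<Sum>r\<in>A. a r *\<^sub>R z r)"
      by (subst sum.reindex) (auto simp: z_def w_def)
    then show ?thesis using pq[rule_format, of "to_nat ` A" "to_nat r" "\<lambda>j. a (from_nat j)"] that by simp
  qed
  have up: "norm (\<Sum>r\<in>A. a r *\<^sub>R z r) \<le> 2 * \<bar>K\<bar> + 4"
    if A: "admissible \<T> s A" and a: "\<forall>r\<in>A. \<bar>a r\<bar> \<le> 1" for A a
  proof -
    define B where "B = {r \<in> A. above (fst r)}"
    have fin: "finite A" and BA: "B \<subseteq> A" using A by (auto simp: admissible_def B_def)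
    have fsts: "r = r'" if "r \<in> A" "r' \<in> A" "fst r = fst r'" for r r'
      using A that unfolding admissible_def by blast
    \<comment> \<open>Outside \<open>B\<close> only the node \<open>s\<close> remains, at most once,
      with a difference of two vectors of norm at most 2.\<close>
    have root: "norm (\<Sum>r\<in>A - B. a r *\<^sub>R z r) \<le> 4"
    proof (cases "A - B = {}")
      case True
      then show ?thesis by (metis norm_zero sum.empty zero_le_numeral)
    next
      case False
      then obtain r0 where r0: "r0 \<in> A - B" by blast
      have node: "fst r = s" if "r \<in> A - B" for r
        using A that by (auto simp: admissible_def B_def above_def strict_prefix_def)
      have "r = r0" if "r \<in> A - B" for r
        using fsts[of r r0] node[OF that] node[OF r0] that r0 by simp
      then have "A - B = {r0}" using r0 by blast
      moreover have "norm (a r0 *\<^sub>R z r0) \<le> 1 * 4"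
      proof -
        have "\<not> above (fst r0)" using r0 by (simp add: B_def)
        then have "norm (z r0) \<le> 4"
          using norm_triangle_ineq4[of "w0 (p (to_nat r0))" "w0 (q (to_nat r0))"]
            w0(1)[of "p (to_nat r0)"] w0(1)[of "q (to_nat r0)"] by (simp add: z_def W_def)
        then show ?thesis using a r0 unfolding norm_scaleR by (intro mult_mono) auto
      qed
      ultimately show ?thesis by simp
    qed
    have tree: "norm (\<Sum>r\<in>B. a r *\<^sub>R z r) \<le> 2 * \<bar>K\<bar>"
    proof (cases "B = {}")
      case False
      then obtain r0 where r0: "r0 \<in> B" by blast
      define d where "d = child (fst r0)"
      have ab: "above (fst r)" if "r \<in> B" for r using that by (simp add: B_def)
      \<comment> \<open>Two nodes of a chain are prefixes of a common node, which determines the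
        child of both.\<close>
      have same: "child (fst r) = d" if "r \<in> B" for r
      proof -
        have "prefix (fst r) (fst r0) \<or> prefix (fst r0) (fst r)"
          using A that r0 BA by (cases "r = r0") (auto simp: admissible_def)
        then obtain t where "prefix (fst r) t" "prefix (fst r0) t" by blast
        then have "prefix (s @ [child (fst r)]) t" "prefix (s @ [d]) t"
          using prefix_order.trans[OF child(1)[OF ab[OF that]]] prefix_order.trans[OF child(1)[OF ab[OF r0]]]
          by (simp_all add: d_def)
        then have "s @ [child (fst r)] = s @ [d]"
          by (auto simp: prefix_def)
        then show ?thesis by simp
      qed
      have pre: "prefix (s @ [d]) (fst r)" if "r \<in> B" for r using child(1)[OF ab[OF that]] same[OF that] by simp
      have dT: "s @ [d] \<in> \<T>" using child(2)[OF ab[OF r0]] by (simp add: d_def)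
      \<comment> \<open>Admissibility does not constrain the numbers at distinct nodes, so the
        minuends and the subtrahends of the differences each form an admissible choice.\<close>
      have half: "norm (\<Sum>r\<in>B. a r *\<^sub>R X d (fst r, h r)) \<le> \<bar>K\<bar>" for h
      proof (rule tree_family_upper_inj[OF X[OF dT], where g = "\<lambda>r. (fst r, h r)"])
        show "inj_on (\<lambda>r. (fst r, h r)) B" by (rule inj_onI) (use fsts BA in blast)
        show "admissible \<T> (s @ [d]) ((\<lambda>r. (fst r, h r)) ` B)"
          unfolding admissible_def
        proof (intro conjI ballI impI)
          show "finite ((\<lambda>r. (fst r, h r)) ` B)" using finite_subset[OF BA fin] by simp
        next
          fix u assume "u \<in> (\<lambda>r. (fst r, h r)) ` B"
          then show "fst u \<in> \<T>" "prefix (s @ [d]) (fst u)" using ab pre by (auto simp: above_def)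
        next
          fix u v assume uv: "u \<in> (\<lambda>r. (fst r, h r)) ` B" "v \<in> (\<lambda>r. (fst r, h r)) ` B" "u \<noteq> v"
          obtain r where r: "r \<in> B" "u = (fst r, h r)" using uv(1) by (rule imageE)
          obtain r' where r': "r' \<in> B" "v = (fst r', h r')" using uv(2) by (rule imageE)
          have "r \<in> A" "r' \<in> A" "r \<noteq> r'" "fst u = fst r" "fst v = fst r'"
            using r r' BA uv(3) by auto
          then show "fst u \<noteq> fst v" "prefix (fst u) (fst v) \<or> prefix (fst v) (fst u)"
            using A unfolding admissible_def by metis+
        qed
        show "\<forall>r\<in>B. \<bar>a r\<bar> \<le> 1" using a BA by blast
      qed
      have "(\<Sum>r\<in>B. a r *\<^sub>R z r)
          = (\<Sum>r\<in>B. a r *\<^sub>R X d (fst r, p (to_nat r))) - (\<Sum>r\<in>B. a r *\<^sub>R X d (fst r, q (to_nat r)))"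
        using ab same by (simp add: z_def W_def scaleR_diff_right flip: sum_subtractf)
      then show ?thesis
        using half[of "\<lambda>r. p (to_nat r)"] half[of "\<lambda>r. q (to_nat r)"]
          norm_triangle_ineq4[of "\<Sum>r\<in>B. a r *\<^sub>R X d (fst r, p (to_nat r))"
            "\<Sum>r\<in>B. a r *\<^sub>R X d (fst r, q (to_nat r))"] by simp
    qed simp
    have "(\<Sum>r\<in>A. a r *\<^sub>R z r) = (\<Sum>r\<in>A - B. a r *\<^sub>R z r) + (\<Sum>r\<in>B. a r *\<^sub>R z r)"
      using sum.subset_diff[OF BA fin] .
    then show ?thesis
      using norm_triangle_ineq[of "\<Sum>r\<in>A - B. a r *\<^sub>R z r" "\<Sum>r\<in>B. a r *\<^sub>R z r"] root tree by simp
  qed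
  have "\<exists>x :: 'd list \<times> nat \<Rightarrow> 'a. (\<forall>A a. finite A \<longrightarrow> (\<forall>p\<in>A. \<bar>a p\<bar> \<le> norm (\<Sum>r\<in>A. a r *\<^sub>R x r))) \<and>
    (\<forall>A a. A \<in> Collect (admissible \<T> s) \<longrightarrow> (\<forall>r\<in>A. \<bar>a r\<bar> \<le> 1) \<longrightarrow> norm (\<Sum>r\<in>A. a r *\<^sub>R x r) \<le> \<bar>K\<bar>)"
  proof (rule elastic_renorming[OF el, where C = 4 and z = z and M = "2 * \<bar>K\<bar> + 4"])
    show "finite A" if "A \<in> Collect (admissible \<T> s)" for A using that by (simp add: admissible_def)
    show "norm (\<Sum>r\<in>A. a r *\<^sub>R z r) \<le> 2 * \<bar>K\<bar> + 4"
      if "A \<in> Collect (admissible \<T> s)" "\<forall>r\<in>A. \<bar>a r\<bar> \<le> 1" for A a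
      using up that by simp
  qed (use low in auto)
  then show ?thesis by (simp add: tree_family_def)
qed

section \<open>An infinite branch of the tree, and the conclusion\<close>

text \<open>Well-founded induction would give a family at the root \<open>[]\<close>. Following at
  each node an index that approximates the vector there, one would obtain an infinite
  branch.\<close>

lemma c0_tree_not_wf:
  fixes e :: "nat \<Rightarrow> 'a::banach"
  assumes el: "K_elastic K TYPE('a)" and inf: "infinite_dimensional TYPE('a)"
    and dense: "\<And>v r. 0 < r \<Longrightarrow> \<exists>k. dist (e k) v < r"
  defines "\<T> \<equiv> c0_tree e (\<bar>K\<bar> + 1)"
  shows "\<not> wf {(s @ [d], s) | s d. s @ [d] \<in> \<T>}"
proof
  assume wf: "wf {(s @ [d], s) | s d. s @ [d] \<in> \<T>}" (is "wf ?R")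
  have "\<exists>x :: nat list \<times> nat \<Rightarrow> 'a. tree_family K \<T> s x" for s
    using wf
  proof (induction s rule: wf_induct_rule)
    case (less s)
    show ?case
      by (rule tree_family_step[OF el inf]) (use less c0_tree_prefix in \<open>auto simp: \<T>_def\<close>)
  qed
  then obtain x :: "nat list \<times> nat \<Rightarrow> 'a" where x: "tree_family K \<T> [] x" by blast
  \<comment> \<open>The tolerance at depth \<open>length s\<close> is the one that
    \<open>c0_like_perturb\<close> allows for the entry at that position.\<close>
  have "\<forall>s. \<exists>k. dist (e k) (x (s, 0)) < (1 / 2) ^ (length s + 2)" by (intro allI dense) simp
  then obtain d where d: "\<And>s. dist (e (d s)) (x (s, 0)) < (1 / 2) ^ (length s + 2)"
    by metis
  define S where "S = rec_nat [] (\<lambda>_ s. s @ [d s])"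
  have S: "S 0 = []" "S (Suc k) = S k @ [d (S k)]" for k by (simp_all add: S_def)
  have len: "length (S k) = k" for k by (induction k) (simp_all add: S)
  have pre: "prefix (S i) (S j)" if "i \<le> j" for i j
    using that by (induction rule: dec_induct) (auto simp: S)
  have nth: "S k ! i = d (S i)" if "i < k" for i k
    using pre[of "Suc i" k] that len[of i] by (auto simp: S prefix_def nth_append)
  have "S k \<in> \<T>" for k
  \<comment> \<open>Entry \<open>i\<close> of \<open>S k\<close> approximates the vector at
    \<open>S i\<close> with \<open>i < k\<close>; so only proper prefixes of \<open>S k\<close> must
    already lie in the tree.\<close>
  proof (induction k rule: less_induct)
    case (less k)
    define g where "g i = (S i, 0::nat)" for i
    have inj: "inj_on g B" for B using len by (metis g_def inj_onI prod.inject)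
    have adm: "admissible \<T> [] (g ` {..<k})"
      using less pre by (auto simp: admissible_def g_def) (metis nat_le_linear)
    have "c0_like (\<bar>K\<bar> + 1) (\<lambda>i. e (S k ! i)) k"
    proof (rule c0_like_perturb[where x = "\<lambda>i. x (g i)"])
      fix a :: "nat \<Rightarrow> real" and i assume i: "i < k"
      \<comment> \<open>The length of a node recovers its position on the branch, which carries the
        coefficients over to pairs.\<close>
      have "(\<Sum>r\<in>g ` {..<k}. a (length (fst r)) *\<^sub>R x r) = (\<Sum>i<k. a i *\<^sub>R x (g i))"
        by (subst sum.reindex[OF inj]) (simp add: g_def len)
      with tree_family_lower[OF x, of "g ` {..<k}" "g i" "\<lambda>r. a (length (fst r))"] i
      show "\<bar>a i\<bar> \<le> norm (\<Sum>i<k. a i *\<^sub>R x (g i))" by (simp add: g_def len)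
    next
      fix a :: "nat \<Rightarrow> real" assume "\<forall>i<k. \<bar>a i\<bar> \<le> 1"
      then show "norm (\<Sum>i<k. a i *\<^sub>R x (g i)) \<le> \<bar>K\<bar>"
        by (intro tree_family_upper_inj[OF x inj adm]) auto
    next
      fix i assume "i < k"
      then show "norm (e (S k ! i) - x (g i)) \<le> (1 / 2) ^ (i + 2)"
        using d[of "S i"] by (simp add: nth g_def len dist_norm)
    qed
    then show ?case by (simp add: \<T>_def c0_tree_def len)
  qed
  then have "\<forall>k. (S (Suc k), S k) \<in> ?R" using S by (metis (mono_tags, lifting) mem_Collect_eq)
  then show False using wf unfolding wf_iff_no_infinite_down_chain by blast
qed

lemma c0_tree_branch:
  fixes e :: "nat \<Rightarrow> 'a::real_normed_vector"
  assumes f: "\<And>k. (f (Suc k), f k) \<in> {(s @ [d], s) | s d. s @ [d] \<in> c0_tree e M}"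
  shows "\<exists>b :: nat \<Rightarrow> 'a. \<forall>n. c0_like M b n"
proof -
  have step: "\<exists>d. f (Suc k) = f k @ [d]" and tree: "f (Suc k) \<in> c0_tree e M" for k
    using f[of k] by auto
  have len: "k \<le> length (f k)" for k
  proof (induction k)
    case (Suc k)
    then show ?case using step[of k] by auto
  qed simp
  have pre: "prefix (f i) (f j)" if "i \<le> j" for i j
    using that
  proof (induction rule: dec_induct)
    case (step n)
    then show ?case using \<open>\<And>k. \<exists>d. f (Suc k) = f k @ [d]\<close>[of n] by auto
  qed simp
  have nth: "f (Suc n) ! i = f (Suc i) ! i" if "i < n" for i n
    using pre[of "Suc i" "Suc n"] len[of "Suc i"] that by (auto simp: prefix_def nth_append)
  \<comment> \<open>The chain may start at a nonempty \<open>f 0\<close>, so lengths are only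
    bounded below; entry \<open>i\<close> is stable from \<open>f (Suc i)\<close> on.\<close>
  have "c0_like M (\<lambda>i. e (f (Suc i) ! i)) n" for n
  proof -
    have "c0_like M (\<lambda>i. e (f (Suc n) ! i)) n"
      using tree[of n] len[of "Suc n"] by (auto simp: c0_tree_def intro: c0_like_mono)
    then show ?thesis
      using c0_like_cong[of n "\<lambda>i. e (f (Suc n) ! i)" "\<lambda>i. e (f (Suc i) ! i)" M] nth by simp
  qed
  then show ?thesis by blast
qed

theorem theorem2p6:
  assumes "separable_space TYPE('a::banach)"
    and "infinite_dimensional TYPE('a)"
    and "elastic TYPE('a)"
  shows "contains_c0 TYPE('a)"
proof -
  obtain K where K: "K_elastic K TYPE('a)" using assms(3) by (auto simp: elastic_def)
  obtain D :: "'a set" where D: "countable D" "closure D = UNIV"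
    using assms(1) by (auto simp: separable_space_def)
  define e where "e = from_nat_into D"
  have "\<exists>k. dist (e k) v < r" if r: "0 < r" for v r
  proof -
    obtain y where "y \<in> D" "dist y v < r"
      using D(2) r closure_approachable[of v D] by auto
    then show ?thesis using from_nat_into_surj[OF D(1)] by (metis e_def)
  qed
  from c0_tree_not_wf[OF K assms(2) this]
  obtain f where "\<And>k. (f (Suc k), f k) \<in> {(s @ [d], s) | s d. s @ [d] \<in> c0_tree e (\<bar>K\<bar> + 1)}"
    unfolding wf_iff_no_infinite_down_chain by blast
  then have "\<exists>b :: nat \<Rightarrow> 'a. \<forall>n. c0_like (\<bar>K\<bar> + 1) b n" by (rule c0_tree_branch)
  then obtain b :: "nat \<Rightarrow> 'a" where "\<And>n. c0_like (\<bar>K\<bar> + 1) b n" by blast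
  then show ?thesis by (rule contains_c0_if_c0_like) simp
qed

end
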